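(* Let $\Lambda$ be a nonempty set and let $\mathscr A$ be a subalgebra of $\mathscr L(c_{00}(\Lambda))$ which contains $\mathscr A_0=\operatorname{span}\{e_\lambda\otimes\varphi_{e_\mu}:\ \lambda,\mu\in\Lambda\}$. If $\Phi\colon\mathscr A\to\mathscr A$ is a positive algebra automorphism, then there exist a permutation operator $P$ and a positive invertible diagonal operator $D$ on $c_{00}(\Lambda)$ such that $$\Phi(T)=PDTD^{-1}P^{-1}\qquad\text{for all } T\in\mathscr A.$$
   Context: $c_{00}(\Lambda)$ is the real vector lattice of all finitely supported real functions on $\Lambda$ with pointwise order, $e_\lambda$ is the characteristic function of $\{\lambda\}$, and $\varphi_{e_\lambda}(x)=x(\lambda)$. $\mathscr L(c_{00}(\Lambda))$ is the algebra of all linear operators on $c_{00}(\Lambda)$. For a vector $u$ and a linear functional $\varphi$, $u\otimes\varphi$ is the operator $x\mapsto\varphi(x)u$. A permutation operator is a linear operator $P$ with $Pe_\lambda=e_{\pi(\lambda)}$ for all $\lambda$, for some bijection $\pi\colon\Lambda\to\Lambda$. A diagonal operator is a linear operator $D$ with $De_\lambda=\delta_\lambda e_\lambda$ for real scalars $\delta_\lambda$; it is positive and invertible iff all $\delta_\lambda>0$. An operator $T$ is positive if $Tx\ge0$ for all $x\ge0$. A positive algebra automorphism of $\mathscr A$ is a bijective linear multiplicative map $\Phi\colon\mathscr A\to\mathscr A$ with $\Phi(T)\ge0$ whenever $T\ge0$. *)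

theory Defs
  imports "HOL-Analysis.Finite_Function_Topology" "HOL-Library.Function_Algebras"
begin

text \<open>
  The space \<open>c\<^sub>0\<^sub>0(\<Lambda>)\<close>, where \<open>\<Lambda>\<close> is the type \<open>'a\<close>; \<open>Finite_Function_Topology\<close> makes it
  a real vector space with pointwise scaling. Its topology plays no role here.
\<close>

type_synonym 'a c00 = "'a \<Rightarrow>\<^sub>0 real"

text \<open>
  Operators are functions on \<open>c\<^sub>0\<^sub>0(\<Lambda>)\<close>; addition and scaling of operators are pointwise,
  their algebra product is composition.
\<close>

instantiation "fun" :: (type, real_vector) real_vector
begin

definition scaleR_fun :: "real \<Rightarrow> ('a \<Rightarrow> 'b) \<Rightarrow> ('a \<Rightarrow> 'b)"
  where "c *\<^sub>R f = (\<lambda>x. c *\<^sub>R f x)"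

instance
  by standard (simp_all add: scaleR_fun_def fun_eq_iff scaleR_add_right scaleR_add_left)

end

type_synonym 'a oper = "'a c00 \<Rightarrow> 'a c00"

definition linear_operators :: "'a oper set"
  where "linear_operators = {T. linear T}"

text \<open>
  The library's order \<open>\<le>\<close> on \<open>poly_mapping\<close> (for linearly ordered index types) is
  lexicographic, so the pointwise order gets a name of its own.
\<close>

definition le_pointwise :: "'a c00 \<Rightarrow> 'a c00 \<Rightarrow> bool"
  where "le_pointwise x y \<longleftrightarrow> (\<forall>l. Poly_Mapping.lookup x l \<le> Poly_Mapping.lookup y l)"

definition positive_operator :: "'a oper \<Rightarrow> bool"
  where "positive_operator T \<longleftrightarrow> linear T \<and> (\<forall>x. le_pointwise 0 x \<longrightarrow> le_pointwise 0 (T x))"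

definition unit_vec :: "'a \<Rightarrow> 'a c00"
  where "unit_vec l = Poly_Mapping.single l 1"

definition coord :: "'a \<Rightarrow> 'a c00 \<Rightarrow> real"
  where "coord l x = Poly_Mapping.lookup x l"

definition rank_one :: "'a c00 \<Rightarrow> ('a c00 \<Rightarrow> real) \<Rightarrow> 'a oper"  (infix \<open>\<otimes>\<^sub>o\<close> 75)
  where "u \<otimes>\<^sub>o \<phi> = (\<lambda>x. \<phi> x *\<^sub>R u)"

definition matrix_units_span :: "'a oper set"
  where "matrix_units_span = span {unit_vec l \<otimes>\<^sub>o coord m | l m. True}"

text \<open>A subalgebra need not contain the identity operator.\<close>

definition operator_subalgebra :: "'a oper set \<Rightarrow> bool"
  where "operator_subalgebra A \<longleftrightarrow>
    A \<subseteq> linear_operators \<and> subspace A \<and> (\<forall>S\<in>A. \<forall>T\<in>A. S \<circ> T \<in> A)"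

text \<open>
  Only the forward implication \<open>T \<ge> 0 \<Longrightarrow> \<Phi> T \<ge> 0\<close> is required, and only on \<open>A\<close>;
  the values of \<open>\<Phi>\<close> outside \<open>A\<close> are irrelevant.
\<close>

definition positive_algebra_automorphism :: "'a oper set \<Rightarrow> ('a oper \<Rightarrow> 'a oper) \<Rightarrow> bool"
  where "positive_algebra_automorphism A \<Phi> \<longleftrightarrow>
    bij_betw \<Phi> A A \<and>
    (\<forall>S\<in>A. \<forall>T\<in>A. \<Phi> (S + T) = \<Phi> S + \<Phi> T) \<and>
    (\<forall>c. \<forall>T\<in>A. \<Phi> (c *\<^sub>R T) = c *\<^sub>R \<Phi> T) \<and>
    (\<forall>S\<in>A. \<forall>T\<in>A. \<Phi> (S \<circ> T) = \<Phi> S \<circ> \<Phi> T) \<and>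
    (\<forall>T\<in>A. positive_operator T \<longrightarrow> positive_operator (\<Phi> T))"

definition permutation_operator :: "'a oper \<Rightarrow> bool"
  where "permutation_operator P \<longleftrightarrow>
    linear P \<and> (\<exists>\<pi>. bij \<pi> \<and> (\<forall>l. P (unit_vec l) = unit_vec (\<pi> l)))"

definition diagonal_operator :: "'a oper \<Rightarrow> bool"
  where "diagonal_operator D \<longleftrightarrow>
    linear D \<and> (\<exists>\<delta>. \<forall>l. D (unit_vec l) = \<delta> l *\<^sub>R unit_vec l)"

end

theory Submission
  imports Defs
begin

text \<open>
  Fix an index \<open>o\<close> and a positive vector \<open>w \<noteq> 0\<close> with \<open>\<Phi>(e\<^sub>o \<otimes> coord o) w = w\<close>. The map
  \<open>U y = \<Phi>(y \<otimes> coord o) w\<close> intertwines: \<open>\<Phi>(T) (U y) = U (T y)\<close>, since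
  \<open>T \<circ> (y \<otimes> coord o) = (T y) \<otimes> coord o\<close>. It is injective with positive inverse because
  \<open>\<Phi>(e\<^sub>o \<otimes> coord m) (U y) = y(m) w\<close>, and surjective because \<open>\<Phi>\<close> reaches every \<open>x \<otimes> coord b\<close>.
  A lattice automorphism \<open>U\<close> of \<open>c\<^sub>0\<^sub>0\<close> permutes the rays spanned by the unit vectors, hence it is
  a permutation operator times a positive diagonal operator.
\<close>

section \<open>Coordinates and linear extension from the unit vectors\<close>

lemma lookup_scaleR [simp]: "Poly_Mapping.lookup (c *\<^sub>R x) m = c * Poly_Mapping.lookup (x :: 'a c00) m"
proof -
  have "finite {m. c *\<^sub>R Poly_Mapping.lookup x m \<noteq> 0}"
    by (rule finite_subset[OF _ finite_keys[of x]]) (auto simp: in_keys_iff)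
  then show ?thesis
    by (simp add: scaleR_poly_mapping_def Abs_poly_mapping_inverse)
qed

lemma lookup_unit_vec: "Poly_Mapping.lookup (unit_vec l) m = (if l = m then 1 else 0)"
  by (simp add: unit_vec_def lookup_single when_def)

lemma unit_vec_neq_0: "unit_vec l \<noteq> 0"
  by (metis lookup_unit_vec lookup_zero zero_neq_one)

lemma unit_vec_expansion:
  assumes "finite K" "Poly_Mapping.keys x \<subseteq> K"
  shows "x = (\<Sum>l\<in>K. Poly_Mapping.lookup x l *\<^sub>R unit_vec l)"
proof (rule poly_mapping_eqI)
  fix m
  have "Poly_Mapping.lookup (\<Sum>l\<in>K. Poly_Mapping.lookup x l *\<^sub>R unit_vec l) m
      = (\<Sum>l\<in>K. if l = m then Poly_Mapping.lookup x l else 0)"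
    by (auto simp: lookup_sum lookup_unit_vec intro!: sum.cong)
  also have "\<dots> = Poly_Mapping.lookup x m"
    using assms by (auto simp: in_keys_iff)
  finally show "Poly_Mapping.lookup x m
      = Poly_Mapping.lookup (\<Sum>l\<in>K. Poly_Mapping.lookup x l *\<^sub>R unit_vec l) m" by simp
qed

lemma linear_eq_on_unit_vecs:
  fixes S T :: "'a c00 \<Rightarrow> 'b::real_vector"
  assumes "linear S" "linear T" "\<And>l. S (unit_vec l) = T (unit_vec l)"
  shows "S = T"
proof
  fix x :: "'a c00"
  have x: "x = (\<Sum>l\<in>Poly_Mapping.keys x. Poly_Mapping.lookup x l *\<^sub>R unit_vec l)"
    by (rule unit_vec_expansion) auto
  show "S x = T x"
    by (subst (1 2) x) (simp add: linear_sum linear_scale assms)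
qed

definition linear_extension :: "('a \<Rightarrow> 'a c00) \<Rightarrow> 'a oper"
  where "linear_extension u x = (\<Sum>l\<in>Poly_Mapping.keys x. Poly_Mapping.lookup x l *\<^sub>R u l)"

text \<open>Summands outside the support vanish, so one finite index set can serve \<open>x\<close>,
  \<open>y\<close> and \<open>x + y\<close> together; additivity of the extension rests on
  this.\<close>

lemma linear_extension_superset:
  assumes "finite K" "Poly_Mapping.keys x \<subseteq> K"
  shows "linear_extension u x = (\<Sum>l\<in>K. Poly_Mapping.lookup x l *\<^sub>R u l)"
  unfolding linear_extension_def
  using assms by (intro sum.mono_neutral_left) (auto simp: in_keys_iff)

lemma linear_linear_extension: "linear (linear_extension u)"
proof (rule linearI)
  fix x y :: "'a c00" and c :: real
  let ?K = "Poly_Mapping.keys x \<union> Poly_Mapping.keys y"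
  have "Poly_Mapping.keys (x + y) \<subseteq> ?K"
    by (rule keys_add)
  then show "linear_extension u (x + y) = linear_extension u x + linear_extension u y"
    by (simp add: linear_extension_superset[of ?K] lookup_add scaleR_add_left sum.distrib)
  have "Poly_Mapping.keys (c *\<^sub>R x) \<subseteq> Poly_Mapping.keys x"
    by (auto simp: in_keys_iff)
  then show "linear_extension u (c *\<^sub>R x) = c *\<^sub>R linear_extension u x"
    by (simp add: linear_extension_superset[of "Poly_Mapping.keys x"] scaleR_sum_right)
qed

lemma linear_extension_unit_vec [simp]: "linear_extension u (unit_vec l) = u l"
  by (simp add: linear_extension_def unit_vec_def)

lemma positive_linear_extension:
  assumes "\<And>l. le_pointwise 0 (u l)"
  shows "positive_operator (linear_extension u)"
  using assms
  by (auto simp: positive_operator_def linear_linear_extension le_pointwise_def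
      linear_extension_def lookup_sum intro!: sum_nonneg)

lemma bij_linear_extension_diagonal:
  assumes "\<And>l. \<delta> l \<noteq> (0::real)"
  shows "bij (linear_extension (\<lambda>l. \<delta> l *\<^sub>R unit_vec l))" (is "bij ?D")
proof (rule o_bij)
  let ?D' = "linear_extension (\<lambda>l. inverse (\<delta> l) *\<^sub>R unit_vec l)"
  show "?D' \<circ> ?D = id" "?D \<circ> ?D' = id"
    by (rule linear_eq_on_unit_vecs;
        simp add: linear_compose linear_linear_extension linear_id linear_scale assms)+
qed

lemma bij_linear_extension_permutation:
  assumes "bij \<pi>"
  shows "bij (linear_extension (\<lambda>l. unit_vec (\<pi> l)))" (is "bij ?P")
proof (rule o_bij)
  let ?P' = "linear_extension (\<lambda>l. unit_vec (inv \<pi> l))"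
  show "?P' \<circ> ?P = id" "?P \<circ> ?P' = id"
    using assms
    by (auto intro!: linear_eq_on_unit_vecs
        simp: linear_compose linear_linear_extension linear_id bij_is_inj bij_is_surj surj_f_inv_f)
qed

section \<open>Lattice automorphisms of the space as weighted permutations\<close>

text \<open>The positive vector \<open>V (unit_vec a)\<close> dominates a positive multiple of some
  \<open>unit_vec l\<close>. Applying \<open>U\<close> traps that multiple of
  \<open>U (unit_vec l)\<close> between 0 and \<open>unit_vec a\<close>, and only multiples of
  \<open>unit_vec a\<close> lie there.\<close>

lemma bipositive_unit_vec_preimage:
  assumes U: "positive_operator U" and V: "positive_operator V"
    and UV: "\<And>x. U (V x) = x" and VU: "\<And>x. V (U x) = x"
  shows "\<exists>l d. d > 0 \<and> U (unit_vec l) = d *\<^sub>R unit_vec a"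
proof -
  have lin: "linear U" using U by (simp add: positive_operator_def)
  have mono: "le_pointwise 0 x \<Longrightarrow> Poly_Mapping.lookup (U x) m \<ge> 0" for x m
    using U by (auto simp: positive_operator_def le_pointwise_def)
  define y where "y = V (unit_vec a)"
  have y0: "Poly_Mapping.lookup y l \<ge> 0" for l
    using V by (auto simp: y_def positive_operator_def le_pointwise_def lookup_unit_vec)
  have Uy: "U y = unit_vec a" by (simp add: y_def UV)
  have "y \<noteq> 0" using Uy lin linear_0 unit_vec_neq_0 by metis
  then obtain l where "Poly_Mapping.lookup y l \<noteq> 0"
    by (metis lookup_zero poly_mapping_eqI)
  with y0[of l] have yl: "Poly_Mapping.lookup y l > 0" by simp
  let ?c = "Poly_Mapping.lookup y l" and ?u = "U (unit_vec l)"
  have u0: "Poly_Mapping.lookup ?u m \<ge> 0" for m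
    by (rule mono) (simp add: le_pointwise_def lookup_unit_vec)
  \<comment> \<open>Removing the coordinate at \<open>l\<close> leaves a positive vector, whose
    image under \<open>U\<close> is again positive.\<close>
  have "le_pointwise 0 (y - ?c *\<^sub>R unit_vec l)"
    using y0 by (auto simp: le_pointwise_def lookup_minus lookup_unit_vec)
  from mono[OF this] have
    le: "?c * Poly_Mapping.lookup ?u m \<le> Poly_Mapping.lookup (unit_vec a) m" for m
    by (simp add: linear_diff[OF lin] linear_scale[OF lin] lookup_minus Uy)
  have z: "Poly_Mapping.lookup ?u m = 0" if "m \<noteq> a" for m
    using le[of m] u0[of m] yl that by (simp add: lookup_unit_vec mult_le_0_iff)
  have eq: "?u = Poly_Mapping.lookup ?u a *\<^sub>R unit_vec a"
    by (rule poly_mapping_eqI) (auto simp: lookup_unit_vec z)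
  have "?u \<noteq> 0"
    by (metis VU lin linear_0 unit_vec_neq_0)
  then have "Poly_Mapping.lookup ?u a \<noteq> 0" using eq by auto
  with u0[of a] have "Poly_Mapping.lookup ?u a > 0" by simp
  with eq show ?thesis by blast
qed

text \<open>The preceding lemma is used in both directions: for \<open>V\<close> it shows that
  \<open>U\<close> maps each unit vector into a ray of a unit vector, for \<open>U\<close> that
  every such ray is reached.\<close>

lemma bipositive_permutation_diagonal:
  assumes U: "positive_operator U" and V: "positive_operator V"
    and UV: "\<And>x. U (V x) = x" and VU: "\<And>x. V (U x) = x"
  obtains P D where "permutation_operator P" "bij P"
    "diagonal_operator D" "positive_operator D" "bij D" "U = P \<circ> D"
proof -
  have linU: "linear U" and linV: "linear V"
    using U V by (simp_all add: positive_operator_def)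
  have "\<exists>a d. d > 0 \<and> U (unit_vec l) = d *\<^sub>R unit_vec a" for l
  proof -
    obtain a d where d: "d > 0" "V (unit_vec a) = d *\<^sub>R unit_vec l"
      using bipositive_unit_vec_preimage[OF V U VU UV] by blast
    then have "unit_vec a = d *\<^sub>R U (unit_vec l)"
      by (metis UV linU linear_scale)
    then have "U (unit_vec l) = inverse d *\<^sub>R unit_vec a" using d by simp
    with d show ?thesis by (metis positive_imp_inverse_positive)
  qed
  then obtain \<pi> \<delta> where \<delta>: "\<And>l. \<delta> l > (0::real)"
    and Ue: "\<And>l. U (unit_vec l) = \<delta> l *\<^sub>R unit_vec (\<pi> l)"
    by metis
  \<comment> \<open>The ray determines its index: the coordinate at \<open>\<pi> l\<close> is
    \<open>\<delta> l > 0\<close>.\<close>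
  have ray: "\<pi> l = a" if "U (unit_vec l) = d *\<^sub>R unit_vec a" for l a d
  proof (rule ccontr)
    assume "\<pi> l \<noteq> a"
    then have "Poly_Mapping.lookup (d *\<^sub>R unit_vec a) (\<pi> l) = 0"
      by (simp add: lookup_unit_vec)
    moreover have "Poly_Mapping.lookup (\<delta> l *\<^sub>R unit_vec (\<pi> l)) (\<pi> l) = \<delta> l"
      by (simp add: lookup_unit_vec)
    ultimately show False using \<delta>[of l] that Ue[of l] by (metis less_irrefl)
  qed
  have Ve: "unit_vec l = \<delta> l *\<^sub>R V (unit_vec (\<pi> l))" for l
    by (metis Ue VU linV linear_scale)
  have "bij \<pi>"
  proof (rule bijI)
    show "surj \<pi>"
      using bipositive_unit_vec_preimage[OF U V UV VU] ray by (metis surjI)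
    show "inj \<pi>"
    proof (rule injI, rule ccontr)
      fix l m assume "\<pi> l = \<pi> m" "l \<noteq> m"
      \<comment> \<open>Both sides equal \<open>\<delta> l * \<delta> m\<close> times the common
        vector \<open>V (unit_vec (\<pi> l))\<close>.\<close>
      then have "\<delta> m *\<^sub>R unit_vec l = \<delta> l *\<^sub>R unit_vec m"
        using Ve[of l] Ve[of m] by (simp add: mult.commute)
      then have "Poly_Mapping.lookup (\<delta> m *\<^sub>R unit_vec l) l
          = Poly_Mapping.lookup (\<delta> l *\<^sub>R unit_vec m) l" by simp
      with \<open>l \<noteq> m\<close> \<delta>[of m] show False by (simp add: lookup_unit_vec split: if_splits)
    qed
  qed
  define P where "P = linear_extension (\<lambda>l. unit_vec (\<pi> l))"
  define D where "D = linear_extension (\<lambda>l. \<delta> l *\<^sub>R unit_vec l)"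
  have lin: "linear P" "linear D" by (simp_all add: P_def D_def linear_linear_extension)
  have Pe: "P (unit_vec l) = unit_vec (\<pi> l)" and De: "D (unit_vec l) = \<delta> l *\<^sub>R unit_vec l" for l
    by (simp_all add: P_def D_def)
  show thesis
  proof
    show "permutation_operator P"
      using lin Pe \<open>bij \<pi>\<close> by (auto simp: permutation_operator_def)
    show "diagonal_operator D"
      using lin De by (auto simp: diagonal_operator_def)
    show "bij P" unfolding P_def by (rule bij_linear_extension_permutation) fact
    show "bij D" unfolding D_def using \<delta>
      by (intro bij_linear_extension_diagonal) (metis less_irrefl)
    show "positive_operator D" unfolding D_def using \<delta>
      by (intro positive_linear_extension) (simp add: le_pointwise_def lookup_unit_vec less_imp_le)
    show "U = P \<circ> D"
      by (rule linear_eq_on_unit_vecs)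
        (simp_all add: linU lin linear_compose linear_scale Pe De Ue)
  qed
qed

section \<open>Rank-one operators\<close>

lemma linear_coord: "linear (coord m)"
  by (auto intro!: linearI simp: coord_def lookup_add)

lemma scaleR_fun_apply: "(c *\<^sub>R f) x = c *\<^sub>R f x"
  by (simp add: scaleR_fun_def)

lemma rank_one_add: "(x + y) \<otimes>\<^sub>o \<phi> = x \<otimes>\<^sub>o \<phi> + y \<otimes>\<^sub>o \<phi>"
  by (simp add: rank_one_def fun_eq_iff scaleR_add_right)

lemma rank_one_scaleR: "(c *\<^sub>R x) \<otimes>\<^sub>o \<phi> = c *\<^sub>R (x \<otimes>\<^sub>o \<phi>)"
  by (simp add: rank_one_def fun_eq_iff scaleR_fun_apply)

lemma comp_rank_one: "linear T \<Longrightarrow> T \<circ> (x \<otimes>\<^sub>o \<phi>) = T x \<otimes>\<^sub>o \<phi>"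
  by (simp add: rank_one_def fun_eq_iff linear_scale)

lemma linear_rank_one_coord: "linear (x \<otimes>\<^sub>o coord m)"
  unfolding rank_one_def
  by (rule linearI) (simp_all add: linear_coord linear_add linear_scale scaleR_add_left)

lemma positive_rank_one_coord:
  "le_pointwise 0 x \<Longrightarrow> positive_operator (x \<otimes>\<^sub>o coord m)"
  unfolding positive_operator_def
  by (simp add: linear_rank_one_coord) (simp add: rank_one_def le_pointwise_def coord_def)

text \<open>Finite support of \<open>x\<close> makes the operator a finite combination of matrix
  units. Hence \<open>\<Phi>\<close> may be applied to it for every \<open>x\<close>, as the
  definition of the intertwiner demands.\<close>

lemma rank_one_coord_in_span: "x \<otimes>\<^sub>o coord m \<in> matrix_units_span"
proof -
  have "(\<Sum>l\<in>K. c l *\<^sub>R unit_vec l) \<otimes>\<^sub>o coord m \<in> matrix_units_span" if "finite K" for K c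
    using that
  proof (induction K rule: finite_induct)
    case empty
    have "(0 :: 'a c00) \<otimes>\<^sub>o coord m = 0" by (simp add: rank_one_def fun_eq_iff)
    then show ?case by (simp only: sum.empty matrix_units_span_def span_zero)
  next
    case (insert l K)
    then show ?case
      unfolding matrix_units_span_def
      by (simp only: sum.insert[OF insert.hyps] rank_one_add rank_one_scaleR)
        (blast intro: span_add span_scale span_base)
  qed
  from this[OF finite_keys] show ?thesis
    using unit_vec_expansion[OF finite_keys subset_refl, of x] by metis
qed

section \<open>The intertwining operator of a positive automorphism\<close>

lemma positive_automorphism_intertwiner:
  fixes A :: "'a oper set"
  assumes A: "operator_subalgebra A" and units: "matrix_units_span \<subseteq> A"
    and \<Phi>: "positive_algebra_automorphism A \<Phi>"
  obtains U V where "positive_operator U" "positive_operator V"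
    "\<And>x. U (V x) = x" "\<And>x. V (U x) = x" "\<And>T. T \<in> A \<Longrightarrow> \<Phi> T \<circ> U = U \<circ> T"
proof -
  have bij: "bij_betw \<Phi> A A"
    and add: "\<And>S T. S \<in> A \<Longrightarrow> T \<in> A \<Longrightarrow> \<Phi> (S + T) = \<Phi> S + \<Phi> T"
    and scale: "\<And>c T. T \<in> A \<Longrightarrow> \<Phi> (c *\<^sub>R T) = c *\<^sub>R \<Phi> T"
    and mult: "\<And>S T. S \<in> A \<Longrightarrow> T \<in> A \<Longrightarrow> \<Phi> (S \<circ> T) = \<Phi> S \<circ> \<Phi> T"
    and pos: "\<And>T. T \<in> A \<Longrightarrow> positive_operator T \<Longrightarrow> positive_operator (\<Phi> T)"
    using \<Phi> unfolding positive_algebra_automorphism_def by auto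
  have lin: "linear T" if "T \<in> A" for T
    using A that by (auto simp: operator_subalgebra_def linear_operators_def)
  have \<Phi>A: "\<Phi> T \<in> A" if "T \<in> A" for T
    using bij that by (auto simp: bij_betw_def)
  have inA: "x \<otimes>\<^sub>o coord m \<in> A" for x m
    by (rule subsetD[OF units rank_one_coord_in_span])
  \<comment> \<open>Any index will do; types are inhabited, which reflects that the index set is
    nonempty.\<close>
  define z :: 'a where "z = undefined"
  define E where "E = unit_vec z \<otimes>\<^sub>o coord z"
  have E: "E \<in> A" by (simp add: E_def inA)
  have EE: "E \<circ> E = E"
    by (simp add: E_def rank_one_def fun_eq_iff coord_def lookup_unit_vec)
  have lE: "linear (\<Phi> E)" using E \<Phi>A lin by blast
  have pe: "le_pointwise 0 (unit_vec l)" for l :: 'a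
    by (simp add: le_pointwise_def lookup_unit_vec)
  \<comment> \<open>If no such \<open>b\<close> existed, \<open>\<Phi> E\<close> would vanish, and
    injectivity of \<open>\<Phi>\<close> on \<open>A\<close> would force
    \<open>E = 0\<close>.\<close>
  obtain b where b: "\<Phi> E (unit_vec b) \<noteq> 0"
  proof (rule ccontr)
    assume "\<not> thesis"
    then have "\<Phi> E (unit_vec b) = 0" for b using that by blast
    then have "\<Phi> E = 0"
      by (intro linear_eq_on_unit_vecs lE) (auto intro: linear_zero simp: zero_fun_def)
    then have "\<Phi> E = \<Phi> (0 *\<^sub>R E)" using scale[OF E, of 0] by simp
    then have "E = 0 *\<^sub>R E"
      using bij E A by (metis bij_betw_def inj_on_def operator_subalgebra_def subspace_scale)
    then have "E (unit_vec z) = 0" by simp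
    then show False
      by (simp add: E_def rank_one_def coord_def lookup_unit_vec unit_vec_neq_0)
  qed
  \<comment> \<open>A vector in the range of the idempotent \<open>\<Phi> E\<close> is fixed by
    it.\<close>
  define w where "w = \<Phi> E (unit_vec b)"
  have w: "w \<noteq> 0" "le_pointwise 0 w" "\<Phi> E w = w"
  proof -
    show "w \<noteq> 0" using b w_def by simp
    have "positive_operator (\<Phi> E)"
      using pos[OF E] positive_rank_one_coord[OF pe] by (simp add: E_def)
    then show "le_pointwise 0 w" using pe by (simp add: w_def positive_operator_def)
    show "\<Phi> E w = w" using mult[OF E E] by (simp add: EE w_def fun_eq_iff)
  qed
  obtain c where "Poly_Mapping.lookup w c \<noteq> 0"
    using w by (metis lookup_zero poly_mapping_eqI)
  then have c: "Poly_Mapping.lookup w c > 0"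
    using w by (metis le_pointwise_def lookup_zero less_le)
  define U where "U = (\<lambda>y. \<Phi> (y \<otimes>\<^sub>o coord z) w)"
  have Uint: "\<Phi> T (U y) = U (T y)" if "T \<in> A" for T y
    using mult[OF that inA[of y z]] comp_rank_one[OF lin[OF that], of y "coord z"]
    by (simp add: U_def fun_eq_iff)
  have linU: "linear U"
    by (rule linearI)
      (simp_all add: U_def rank_one_add rank_one_scaleR add scale inA scaleR_fun_apply)
  have posU: "positive_operator U"
    using linU pos[OF inA positive_rank_one_coord] w
    by (simp add: positive_operator_def U_def)
  have Uz: "U (unit_vec z) = w" using w by (simp add: U_def E_def)
  \<comment> \<open>Intertwining turns the left side into \<open>U\<close> of \<open>y(m)\<close>
    times \<open>unit_vec z\<close>, so each coordinate of \<open>y\<close> can be read off from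
    \<open>U y\<close>.\<close>
  have coord: "\<Phi> (unit_vec z \<otimes>\<^sub>o coord m) (U y) = Poly_Mapping.lookup y m *\<^sub>R w" for m y
    using Uint[OF inA, of "unit_vec z" m y]
    by (simp add: rank_one_def coord_def linear_scale[OF linU] Uz)
  have inj: "inj U"
  proof (rule injI)
    fix x y assume "U x = U y"
    then have "Poly_Mapping.lookup x m *\<^sub>R w = Poly_Mapping.lookup y m *\<^sub>R w" for m
      using coord by metis
    then show "x = y" using w by (intro poly_mapping_eqI) simp
  qed
  have surj: "surj U"
  proof -
    have "\<exists>y. x = U y" for x
    proof -
      \<comment> \<open>Evaluating \<open>\<Phi> T\<close> at \<open>w = U (unit_vec z)\<close>
        gives \<open>w(c)\<close> times \<open>x\<close> on one side and
        \<open>U (T (unit_vec z))\<close> on the other; \<open>w(c) > 0\<close> allows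
        division.\<close>
      obtain T where T: "T \<in> A" "\<Phi> T = x \<otimes>\<^sub>o coord c"
        using bij inA[of x c] by (metis bij_betw_def imageE)
      have eq: "Poly_Mapping.lookup w c *\<^sub>R x = U (T (unit_vec z))"
        using Uint[OF T(1), of "unit_vec z"] by (simp add: T Uz rank_one_def coord_def)
      have "x = U (inverse (Poly_Mapping.lookup w c) *\<^sub>R T (unit_vec z))"
        using c by (simp add: linear_scale[OF linU] flip: eq)
      then show ?thesis by blast
    qed
    then show ?thesis by (simp add: surj_def)
  qed
  have UV: "U (inv U x) = x" for x using surj by (simp add: surj_f_inv_f)
  have VU: "inv U (U x) = x" for x using inj by simp
  have linV: "linear (inv U)"
    by (rule linearI; rule injD[OF inj])
      (simp_all add: UV linear_add[OF linU] linear_scale[OF linU])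
  have posV: "positive_operator (inv U)"
    unfolding positive_operator_def
  proof (intro conjI linV allI impI)
    fix x :: "'a c00" assume x: "le_pointwise 0 x"
    have "0 \<le> Poly_Mapping.lookup (inv U x) m" for m
    proof -
      \<comment> \<open>With \<open>x = U (inv U x)\<close> this positive vector is
        \<open>(inv U x)(m)\<close> times \<open>w\<close>, and its coordinate at \<open>c\<close>
        reveals the sign of the factor.\<close>
      have "le_pointwise 0 (\<Phi> (unit_vec z \<otimes>\<^sub>o coord m) x)"
        using pos[OF inA positive_rank_one_coord[OF pe]] x by (simp add: positive_operator_def)
      then have "le_pointwise 0 (Poly_Mapping.lookup (inv U x) m *\<^sub>R w)"
        using coord[of m "inv U x"] by (simp add: UV)
      then have "0 \<le> Poly_Mapping.lookup (inv U x) m * Poly_Mapping.lookup w c"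
        by (auto simp: le_pointwise_def)
      then show ?thesis using c by (simp add: zero_le_mult_iff)
    qed
    then show "le_pointwise 0 (inv U x)" by (simp add: le_pointwise_def)
  qed
  show thesis
    by (rule that[OF posU posV UV VU]) (simp_all add: fun_eq_iff Uint)
qed

theorem corollary6p3:
  fixes A :: "'a oper set" and \<Phi> :: "'a oper \<Rightarrow> 'a oper"
  assumes "operator_subalgebra A"
    and "matrix_units_span \<subseteq> A"
    and "positive_algebra_automorphism A \<Phi>"
  shows "\<exists>P D. permutation_operator P \<and>
    diagonal_operator D \<and> positive_operator D \<and> bij D \<and>
    (\<forall>T\<in>A. \<Phi> T = P \<circ> D \<circ> T \<circ> inv D \<circ> inv P)"
proof -
  obtain U V where UV: "positive_operator U" "positive_operator V"
    "\<And>x. U (V x) = x" "\<And>x. V (U x) = x" and int: "\<And>T. T \<in> A \<Longrightarrow> \<Phi> T \<circ> U = U \<circ> T"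
    using positive_automorphism_intertwiner[OF assms] by blast
  obtain P D where P: "permutation_operator P" "bij P"
    and D: "diagonal_operator D" "positive_operator D" "bij D" and U: "U = P \<circ> D"
    using bipositive_permutation_diagonal[OF UV] by blast
  have "\<Phi> T = P \<circ> D \<circ> T \<circ> inv D \<circ> inv P" if "T \<in> A" for T
  proof
    fix x
    \<comment> \<open>Since every \<open>x\<close> lies in the range of \<open>U\<close>, the
      intertwining relation determines \<open>\<Phi> T x\<close>.\<close>
    have "x = U (inv D (inv P x))"
      using P D by (simp add: U bij_is_surj surj_f_inv_f)
    then show "\<Phi> T x = (P \<circ> D \<circ> T \<circ> inv D \<circ> inv P) x"
      using fun_cong[OF int[OF that], of "inv D (inv P x)"] by (simp add: U)
  qed
  with P D show ?thesis by blast
qed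

end
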